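(* Let $\mathcal S=\bigcup_{n\ge 0}\mathcal S_n$ be a minors system with deletion $S\backslash\!\backslash e$ and contraction $S/\!/e$, and let $\mathcal H$ be its Hopf algebra, with coproduct $\Delta(S)=\sum_{A\subseteq E(S)}(S\backslash\!\backslash A^c)\otimes(S/\!/A)$. Let $\{S_i\}_{i\in I}$ be the elements of $\mathcal S_1$ (a basis of $\mathcal H_1$), and let $\delta_i$ be the linear map with $\delta_i(S_i)=1$ and $\delta_i(S)=0$ for every other $S\in\mathcal S$. Suppose that for each $j$ in an index set $J$ there is a function $r_j:\mathcal S\to\mathbb Q$ and rational numbers $m_{ij}$ ($i\in I$) such that $r_j(S)=0$ for $S\in\mathcal S_0$, and for every $S\in\mathcal S$ and $e\in E(S)$, $$r_j(S)=r_j(S/\!/e)+m_{ij}\quad\text{whenever }\delta_i\big(S\backslash\!\backslash(E(S)\setminus\{e\})\big)=1.$$ For indeterminates $\{x_j\}_{j\in J}$ and $\{y_j\}_{j\in J}$ put $a_i=\prod_{j\in J}x_j^{m_{ij}}$, $b_i=\prod_{j\in J}y_j^{m_{ij}}$, $\delta_{\mathbf a}=\sum_{i\in I}a_i\delta_i$ and $\delta_{\mathbf b}=\sum_{i\in I}b_i\delta_i$. Then $\delta_{\mathbf a}$ is uniform, and for every $S\in\mathcal S$ $$\alpha(\mathbf a,\mathbf b)(S)=\prod_{j\in J}y_j^{r_j(S)}\sum_{A\subseteq E(S)}\prod_{j\in J}\Big(\frac{x_j}{y_j}\Big)^{r_j(S\backslash\backslash A^c)},$$ where $A^c=E(S)\setminus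 A$.
   Context: A minors system consists of a graded set $\mathcal S=\bigcup_{n\ge0}\mathcal S_n$ of finite combinatorial objects, each $S\in\mathcal S_n$ having an associated set $E(S)$ of exactly $n$ elements, with a unique element $1\in\mathcal S_0$, together with two operations assigning to each $S$ and $e\in E(S)$ objects $S\backslash\!\backslash e$ (deletion) and $S/\!/e$ (contraction) with $E(S\backslash\!\backslash e)=E(S/\!/e)=E(S)\setminus\{e\}$, such that for $e\neq f$: $(S\backslash\!\backslash e)\backslash\!\backslash f=(S\backslash\!\backslash f)\backslash\!\backslash e$, $(S/\!/e)\backslash\!\backslash f=(S\backslash\!\backslash f)/\!/e$, $(S/\!/e)/\!/f=(S/\!/f)/\!/e$. For $A\subseteq E(S)$, $S\backslash\!\backslash A$ and $S/\!/A$ denote applying the operation to all elements of $A$ in any order. The Hopf algebra of the minors system is the free module with basis $\mathcal S$ (over a field $\mathbb K$ of characteristic 0), graded by $\mathcal H_n=\mathrm{span}\,\mathcal S_n$, with the coproduct above, counit $\varepsilon(S)=1$ if $S\in\mathcal S_0$ and $0$ otherwise, and a multiplication $m$ with unit $1$ such that $E(m(S_1\otimes S_2))=E(S_1)\sqcup E(S_2)$ and $m(S_1\backslash\!\backslash A_1\otimes S_2\backslash\!\backslash A_2)=m(S_1\otimes S_2)\backslash\!\backslash(A_1\sqcup A_2)$, and similarly for $/\!/$. For linear maps $f,g$ from $\mathcal H$ to a commutative algebra, $f*g=m\circ(f\otimes g)\circ\Delta$; $\exp_*(\delta)=\sum_{k\ge0}\delta^{*k}/k!$ with $\delta^{*0}=\varepsilon$.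 The (Tutte polynomial) $\alpha(\mathbf a,\mathbf b)=\exp_*(\delta_{\mathbf a})*\exp_*(\delta_{\mathbf b})$, with values in polynomials in the $x_j,y_j$ with rational exponents. A selector $\delta_{\mathbf a}$ is uniform if for every $S\in\mathcal S$ and every $k\ge1$, $\delta_{\mathbf a}^{\otimes k}$ takes the same value on every summand of the iterated coproduct $\Delta^{(k-1)}(S)$ all of whose tensor factors lie in $\mathcal S_1$. *)

theory Defs
  imports Complex_Main "HOL-Library.Poly_Mapping"
begin

section \<open>Minors systems\<close>

text \<open>The graded set of combinatorial objects is the whole type \<open>'s\<close>; the grade of an object is the
  number of elements of its ground set.\<close>

record ('s, 'e) minors =
  ground :: "'s \<Rightarrow> 'e set"
  del :: "'s \<Rightarrow> 'e \<Rightarrow> 's"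
  con :: "'s \<Rightarrow> 'e \<Rightarrow> 's"

definition grade :: "('s, 'e) minors \<Rightarrow> nat \<Rightarrow> 's set"
  where "grade M n = {S. card (ground M S) = n}"

text \<open>Deletion and contraction of a finite set of elements, one after another in some order. That the
  order is irrelevant is proved as \<open>del_set_eq_foldl\<close> and \<open>con_set_eq_foldl\<close> below.\<close>

definition del_set :: "('s, 'e) minors \<Rightarrow> 's \<Rightarrow> 'e set \<Rightarrow> 's"
  where "del_set M S A = foldl (del M) S (SOME es. distinct es \<and> set es = A)"

definition con_set :: "('s, 'e) minors \<Rightarrow> 's \<Rightarrow> 'e set \<Rightarrow> 's"
  where "con_set M S A = foldl (con M) S (SOME es. distinct es \<and> set es = A)"

locale minors_system =
  fixes M :: "('s, 'e) minors" and unit_obj :: 's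
  assumes finite_ground: "finite (ground M S)"
    and grade_0: "grade M 0 = {unit_obj}"
    and ground_del: "e \<in> ground M S \<Longrightarrow> ground M (del M S e) = ground M S - {e}"
    and ground_con: "e \<in> ground M S \<Longrightarrow> ground M (con M S e) = ground M S - {e}"
    and del_del: "\<lbrakk>e \<in> ground M S; f \<in> ground M S; e \<noteq> f\<rbrakk>
      \<Longrightarrow> del M (del M S e) f = del M (del M S f) e"
    and con_del: "\<lbrakk>e \<in> ground M S; f \<in> ground M S; e \<noteq> f\<rbrakk>
      \<Longrightarrow> del M (con M S e) f = con M (del M S f) e"
    and con_con: "\<lbrakk>e \<in> ground M S; f \<in> ground M S; e \<noteq> f\<rbrakk>
      \<Longrightarrow> con M (con M S e) f = con M (con M S f) e"

lemma foldl_order_irrelevant: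
  assumes gr: "\<And>S e. e \<in> g S \<Longrightarrow> g (d S e) = g S - {e}"
    and comm: "\<And>S e f. \<lbrakk>e \<in> g S; f \<in> g S; e \<noteq> f\<rbrakk> \<Longrightarrow> d (d S e) f = d (d S f) e"
    and "distinct es" "distinct fs" "set es = set fs" "set es \<subseteq> g S"
  shows "foldl d S es = foldl d S fs"
  using assms(3-)
proof (induction es arbitrary: S fs)
  case Nil
  then show ?case by simp
next
  case (Cons e es)
  have front: "foldl d S (us @ e # vs) = foldl d (d S e) (us @ vs)"
    if "distinct (us @ [e])" "set us \<subseteq> g S" "e \<in> g S" for us vs S
    using that
  proof (induction us arbitrary: S)
    case Nil
    then show ?case by simp
  next
    case (Cons u us)
    have "foldl d S ((u # us) @ e # vs) = foldl d (d (d S u) e) (us @ vs)"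
      using Cons.IH[of "d S u"] Cons.prems gr[of u S] by auto
    also have "d (d S u) e = d (d S e) u"
      using Cons.prems by (intro comm) auto
    finally show ?case by simp
  qed
  from Cons.prems have "e \<in> set fs" by auto
  then obtain us vs where fs: "fs = us @ e # vs" by (meson split_list)
  have seteq: "set es = set (us @ vs)"
    using Cons.prems(1,2,3) unfolding fs by (auto simp: insert_ident)
  have grd: "g (d S e) = g S - {e}"
    using Cons.prems(4) by (intro gr) simp
  have "foldl d S fs = foldl d (d S e) (us @ vs)"
    unfolding fs using Cons.prems fs by (intro front) auto
  also have "\<dots> = foldl d (d S e) es"
    using Cons.prems(1,2,4) unfolding fs
    by (intro Cons.IH[symmetric]) (simp_all add: seteq grd, auto simp flip: seteq)
  finally show ?case by simp
qed

context minors_system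
begin

lemma del_set_eq_foldl:
  assumes "distinct es" "set es \<subseteq> ground M S"
  shows "del_set M S (set es) = foldl (del M) S es"
proof -
  have "distinct (SOME fs. distinct fs \<and> set fs = set es)
      \<and> set (SOME fs. distinct fs \<and> set fs = set es) = set es"
    by (rule someI[of "\<lambda>fs. distinct fs \<and> set fs = set es" es]) (use assms in simp)
  then show ?thesis
    unfolding del_set_def using assms
    by (intro foldl_order_irrelevant[where g = "ground M"]) (auto simp: ground_del del_del)
qed

lemma con_set_eq_foldl:
  assumes "distinct es" "set es \<subseteq> ground M S"
  shows "con_set M S (set es) = foldl (con M) S es"
proof -
  have "distinct (SOME fs. distinct fs \<and> set fs = set es)
      \<and> set (SOME fs. distinct fs \<and> set fs = set es) = set es"
    by (rule someI[of "\<lambda>fs. distinct fs \<and> set fs = set es" es]) (use assms in simp)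
  then show ?thesis
    unfolding con_set_def using assms
    by (intro foldl_order_irrelevant[where g = "ground M"]) (auto simp: ground_con con_con)
qed

end

text \<open>
  The multiplication of the Hopf algebra, on basis elements. As ground sets are honest sets and
  \<open>E(S\<^sub>1 S\<^sub>2)\<close> is the disjoint union of \<open>E(S\<^sub>1)\<close> and \<open>E(S\<^sub>2)\<close>, it is specified for objects with disjoint
  ground sets; other products only make sense after relabelling. Demanding the axioms for all pairs,
  with fixed injections of \<open>E(S\<^sub>1)\<close> and \<open>E(S\<^sub>2)\<close> into \<open>E(S\<^sub>1 S\<^sub>2)\<close>, would leave only the system \<open>{1}\<close>:
  deleting either copy of \<open>E(S)\<close> from \<open>S S\<close> has to give \<open>S\<close>, so both copies are equal to \<open>E(S)\<close>.
\<close>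

locale minors_hopf_algebra = minors_system M unit_obj
  for M :: "('s, 'e) minors" and unit_obj :: 's +
  fixes mult :: "'s \<Rightarrow> 's \<Rightarrow> 's"
  assumes mult_unit_left: "mult unit_obj S = S"
    and mult_unit_right: "mult S unit_obj = S"
    and mult_assoc:
      "\<lbrakk>ground M S \<inter> ground M T = {}; ground M S \<inter> ground M U = {}; ground M T \<inter> ground M U = {}\<rbrakk>
        \<Longrightarrow> mult (mult S T) U = mult S (mult T U)"
    and ground_mult: "ground M S \<inter> ground M T = {}
        \<Longrightarrow> ground M (mult S T) = ground M S \<union> ground M T"
    and mult_del_set:
      "\<lbrakk>ground M S \<inter> ground M T = {}; A \<subseteq> ground M S; B \<subseteq> ground M T\<rbrakk>
        \<Longrightarrow> mult (del_set M S A) (del_set M T B) = del_set M (mult S T) (A \<union> B)"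
    and mult_con_set:
      "\<lbrakk>ground M S \<inter> ground M T = {}; A \<subseteq> ground M S; B \<subseteq> ground M T\<rbrakk>
        \<Longrightarrow> mult (con_set M S A) (con_set M T B) = con_set M (mult S T) (A \<union> B)"


section \<open>The coalgebra and convolution\<close>

text \<open>
  The free \<open>'k\<close>-module on \<open>'b\<close> is \<open>'b \<Rightarrow>\<^sub>0 'k\<close>. So \<open>H\<close> is \<open>'s \<Rightarrow>\<^sub>0 'k\<close>, its tensor square is
  \<open>('s \<times> 's) \<Rightarrow>\<^sub>0 'k\<close>, and its \<open>k\<close>-th tensor power is the part of \<open>'s list \<Rightarrow>\<^sub>0 'k\<close> spanned by the lists
  of length \<open>k\<close>. If \<open>'v\<close> is a commutative monoid, written additively, then \<open>'v \<Rightarrow>\<^sub>0 'k\<close> with its library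
  multiplication is the monoid algebra of \<open>'v\<close>; linear maps out of \<open>H\<close> take values in such algebras.
\<close>

definition basis :: "'b \<Rightarrow> 'b \<Rightarrow>\<^sub>0 'k::field_char_0"
  where "basis b = Poly_Mapping.single b 1"

definition smult :: "'k::field_char_0 \<Rightarrow> ('b \<Rightarrow>\<^sub>0 'k) \<Rightarrow> 'b \<Rightarrow>\<^sub>0 'k"
  where "smult c h = Poly_Mapping.map ((*) c) h"

definition lin_ext :: "('b \<Rightarrow> ('c \<Rightarrow>\<^sub>0 'k)) \<Rightarrow> ('b \<Rightarrow>\<^sub>0 'k::field_char_0) \<Rightarrow> 'c \<Rightarrow>\<^sub>0 'k"
  where "lin_ext f h = (\<Sum>b\<in>Poly_Mapping.keys h. smult (Poly_Mapping.lookup h b) (f b))"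

definition coproduct ::
    "('s, 'e) minors \<Rightarrow> ('s \<Rightarrow>\<^sub>0 'k::field_char_0) \<Rightarrow> ('s \<times> 's) \<Rightarrow>\<^sub>0 'k"
  where "coproduct M = lin_ext (\<lambda>S. \<Sum>A\<in>Pow (ground M S).
    basis (del_set M S (ground M S - A), con_set M S A))"

definition counit :: "('s, 'e) minors \<Rightarrow> ('s \<Rightarrow>\<^sub>0 'k::field_char_0) \<Rightarrow> 'k"
  where "counit M h = (\<Sum>S\<in>Poly_Mapping.keys h.
    Poly_Mapping.lookup h S * (if S \<in> grade M 0 then 1 else 0))"

text \<open>\<open>iter_coproduct M k\<close> is the iterated coproduct from \<open>H\<close> to the \<open>(k+1)\<close>-st tensor power of \<open>H\<close>.\<close>

fun iter_coproduct ::
    "('s, 'e) minors \<Rightarrow> nat \<Rightarrow> ('s \<Rightarrow>\<^sub>0 'k::field_char_0) \<Rightarrow> 's list \<Rightarrow>\<^sub>0 'k"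
  where
    "iter_coproduct M 0 h = lin_ext (\<lambda>S. basis [S]) h"
  | "iter_coproduct M (Suc k) h =
      lin_ext (\<lambda>(S, T). lin_ext (\<lambda>Ts. basis (S # Ts)) (iter_coproduct M k (basis T)))
        (coproduct M h)"

text \<open>\<open>tensor_mult f g\<close> is \<open>m \<circ> (f \<otimes> g)\<close>, and \<open>tensor_pow f\<close> is, on the \<open>k\<close>-th tensor power, \<open>f\<^bsup>\<otimes>k\<^esup>\<close> followed
  by the multiplication of the algebra of values.\<close>

definition tensor_mult ::
    "(('s \<Rightarrow>\<^sub>0 'k) \<Rightarrow> ('v::comm_monoid_add \<Rightarrow>\<^sub>0 'k)) \<Rightarrow> (('s \<Rightarrow>\<^sub>0 'k) \<Rightarrow> ('v \<Rightarrow>\<^sub>0 'k))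
      \<Rightarrow> (('s \<times> 's) \<Rightarrow>\<^sub>0 'k::field_char_0) \<Rightarrow> 'v \<Rightarrow>\<^sub>0 'k"
  where "tensor_mult f g = lin_ext (\<lambda>(S, T). f (basis S) * g (basis T))"

definition tensor_pow ::
    "(('s \<Rightarrow>\<^sub>0 'k) \<Rightarrow> ('v::comm_monoid_add \<Rightarrow>\<^sub>0 'k)) \<Rightarrow> ('s list \<Rightarrow>\<^sub>0 'k::field_char_0) \<Rightarrow> 'v \<Rightarrow>\<^sub>0 'k"
  where "tensor_pow f = lin_ext (\<lambda>Ts. prod_list (map (\<lambda>T. f (basis T)) Ts))"

definition convolution ::
    "('s, 'e) minors \<Rightarrow> (('s \<Rightarrow>\<^sub>0 'k) \<Rightarrow> ('v::comm_monoid_add \<Rightarrow>\<^sub>0 'k))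
      \<Rightarrow> (('s \<Rightarrow>\<^sub>0 'k) \<Rightarrow> ('v \<Rightarrow>\<^sub>0 'k)) \<Rightarrow> ('s \<Rightarrow>\<^sub>0 'k::field_char_0) \<Rightarrow> 'v \<Rightarrow>\<^sub>0 'k"
  where "convolution M f g = tensor_mult f g \<circ> coproduct M"

fun conv_pow ::
    "('s, 'e) minors \<Rightarrow> (('s \<Rightarrow>\<^sub>0 'k) \<Rightarrow> ('v::comm_monoid_add \<Rightarrow>\<^sub>0 'k)) \<Rightarrow> nat
      \<Rightarrow> ('s \<Rightarrow>\<^sub>0 'k::field_char_0) \<Rightarrow> 'v \<Rightarrow>\<^sub>0 'k"
  where
    "conv_pow M f 0 = (\<lambda>h. smult (counit M h) 1)"
  | "conv_pow M f (Suc k) = convolution M f (conv_pow M f k)"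

text \<open>For \<open>f\<close> vanishing on \<open>S\<^sub>0\<close>, only finitely many terms of the exponential series are nonzero on a
  given element of \<open>H\<close>.\<close>

definition conv_exp ::
    "('s, 'e) minors \<Rightarrow> (('s \<Rightarrow>\<^sub>0 'k) \<Rightarrow> ('v::comm_monoid_add \<Rightarrow>\<^sub>0 'k))
      \<Rightarrow> ('s \<Rightarrow>\<^sub>0 'k::field_char_0) \<Rightarrow> 'v \<Rightarrow>\<^sub>0 'k"
  where "conv_exp M f h = (\<Sum>k. smult (1 / fact k) (conv_pow M f k h))"


section \<open>Selectors and the Tutte polynomial\<close>

text \<open>\<open>coord T\<close> is the linear map with value \<open>1\<close> on \<open>T\<close> and \<open>0\<close> on every other basis element; with
  \<open>obj\<close> enumerating \<open>S\<^sub>1\<close> by \<open>I\<close>, the map \<open>\<delta>\<^sub>i\<close> is \<open>coord (obj i)\<close>.\<close>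

definition coord :: "'s \<Rightarrow> ('s \<Rightarrow>\<^sub>0 'k::field_char_0) \<Rightarrow> 'k"
  where "coord T h = Poly_Mapping.lookup h T"

definition selector ::
    "'i set \<Rightarrow> ('i \<Rightarrow> 's) \<Rightarrow> ('i \<Rightarrow> ('v::comm_monoid_add \<Rightarrow>\<^sub>0 'k))
      \<Rightarrow> ('s \<Rightarrow>\<^sub>0 'k::field_char_0) \<Rightarrow> 'v \<Rightarrow>\<^sub>0 'k"
  where "selector I obj a h = (\<Sum>i. smult (coord (obj i) h) (a i) when i \<in> I)"

text \<open>The summands of the iterated coproduct of \<open>S\<close> are the pure tensors in its support: their
  coefficients are positive integers, so none of them cancel in characteristic 0.\<close>

definition uniform ::
    "('s, 'e) minors \<Rightarrow> (('s \<Rightarrow>\<^sub>0 'k) \<Rightarrow> ('v::comm_monoid_add \<Rightarrow>\<^sub>0 'k::field_char_0)) \<Rightarrow> bool"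
  where "uniform M f \<longleftrightarrow> (\<forall>S. \<forall>k\<ge>1.
    \<forall>Ts \<in> Poly_Mapping.keys (iter_coproduct M (k - 1) (basis S) :: 's list \<Rightarrow>\<^sub>0 'k).
    \<forall>Us \<in> Poly_Mapping.keys (iter_coproduct M (k - 1) (basis S) :: 's list \<Rightarrow>\<^sub>0 'k).
      set Ts \<subseteq> grade M 1 \<longrightarrow> set Us \<subseteq> grade M 1 \<longrightarrow>
      tensor_pow f (basis Ts) = tensor_pow f (basis Us))"

definition tutte_poly ::
    "('s, 'e) minors \<Rightarrow> 'i set \<Rightarrow> ('i \<Rightarrow> 's) \<Rightarrow> ('i \<Rightarrow> ('v::comm_monoid_add \<Rightarrow>\<^sub>0 'k))
      \<Rightarrow> ('i \<Rightarrow> ('v \<Rightarrow>\<^sub>0 'k)) \<Rightarrow> ('s \<Rightarrow>\<^sub>0 'k::field_char_0) \<Rightarrow> 'v \<Rightarrow>\<^sub>0 'k"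
  where "tutte_poly M I obj a b =
    convolution M (conv_exp M (selector I obj a)) (conv_exp M (selector I obj b))"


section \<open>Polynomials with rational exponents\<close>

text \<open>Monomials in the \<open>x\<^sub>j\<close> (\<open>Inl j\<close>) and \<open>y\<^sub>j\<close> (\<open>Inr j\<close>) are given by their finitely supported rational
  exponent vectors.\<close>

type_synonym ('j, 'k) rat_poly = "(('j + 'j) \<Rightarrow>\<^sub>0 rat) \<Rightarrow>\<^sub>0 'k"

definition x_pow :: "'j \<Rightarrow> rat \<Rightarrow> ('j, 'k::field_char_0) rat_poly"
  where "x_pow j q = Poly_Mapping.single (Poly_Mapping.single (Inl j) q) 1"

definition y_pow :: "'j \<Rightarrow> rat \<Rightarrow> ('j, 'k::field_char_0) rat_poly"
  where "y_pow j q = Poly_Mapping.single (Poly_Mapping.single (Inr j) q) 1"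

definition x_div_y_pow :: "'j \<Rightarrow> rat \<Rightarrow> ('j, 'k::field_char_0) rat_poly"
  where "x_div_y_pow j q = x_pow j q * y_pow j (- q)"

text \<open>The product over a possibly infinite index set all but finitely many of whose factors are 1.\<close>

definition prod_over :: "'j set \<Rightarrow> ('j \<Rightarrow> 'a::comm_monoid_mult) \<Rightarrow> 'a"
  where "prod_over J f = (\<Prod>j. if j \<in> J then f j else 1)"

end

theory Submission
  imports Defs
begin

text \<open>
  Both exponential factors of the Tutte polynomial are evaluated by one principle. Let \<open>f\<close> be a
  linear map supported on \<open>S\<^sub>1\<close>, and suppose that a weight \<open>F\<close> with \<open>F = 1\<close> on \<open>S\<^sub>0\<close> satisfies
  \<open>F(S) = f(S \<setminus> (E - e)) F(S / e)\<close> for every \<open>e\<close>. Only singletons \<open>A\<close> contribute to the coproduct when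
  the left factor is fed to \<open>f\<close>, so the \<open>n\<close>-th convolution power of \<open>f\<close> at \<open>S \<in> S\<^sub>n\<close> peels off one element
  at a time, in \<open>n!\<close> orders, each of which gives \<open>F(S)\<close>; hence \<open>f\<close> is uniform and its exponential is
  \<open>F\<close>. The recursion for \<open>r\<^sub>j\<close> says that \<open>F(S) = \<Prod>\<^sub>j x\<^sub>j\<^bsup>r\<^sub>j(S)\<^esup>\<close> is such a weight. Finally
  \<open>r\<^sub>j(S) = r\<^sub>j(S / A) + r\<^sub>j(S \<setminus> A\<^sup>c)\<close>, by peeling off the elements of \<open>A\<close>, which turns the
  convolution of the two exponentials into the stated sum.
\<close>

section \<open>Linear maps on free modules\<close>

lemma lookup_smult [simp]: "Poly_Mapping.lookup (smult c h) x = c * Poly_Mapping.lookup h x"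
  by (simp add: smult_def Poly_Mapping.map.rep_eq when_def)

lemma smult_one [simp]: "smult 1 h = h"
  by (rule poly_mapping_eqI) simp

lemma smult_zero_left [simp]: "smult 0 h = 0"
  by (rule poly_mapping_eqI) simp

lemma smult_zero_right [simp]: "smult c 0 = 0"
  by (rule poly_mapping_eqI) simp

lemma smult_smult [simp]: "smult c (smult d h) = smult (c * d) h"
  by (rule poly_mapping_eqI) (simp add: mult.assoc)

lemma smult_add_left: "smult (c + d) h = smult c h + smult d h"
  by (rule poly_mapping_eqI) (simp add: lookup_add algebra_simps)

text \<open>A scalar becomes a constant of the monoid algebra, so commutativity there lets it move
  through products.\<close>

lemma smult_eq_single_times: "smult c h = Poly_Mapping.single 0 c * h"
  for h :: "'v::comm_monoid_add \<Rightarrow>\<^sub>0 'k::field_char_0"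
  by (rule poly_mapping_eqI) (simp add: smult_def flip: mult_map_scale_conv_mult)

lemma mult_smult_right: "f * smult c h = smult c (f * h)"
  for f h :: "'v::comm_monoid_add \<Rightarrow>\<^sub>0 'k::field_char_0"
  by (simp add: smult_eq_single_times ac_simps)

lemma sum_const_smult: "(\<Sum>x\<in>A. h) = smult (of_nat (card A)) h"
proof (induction A rule: infinite_finite_induct)
  case (insert x A)
  then show ?case by (simp add: smult_add_left)
qed auto

lemma lookup_basis: "Poly_Mapping.lookup (basis b) c = (if b = c then 1 else 0)"
  by (simp add: basis_def lookup_single when_def)

lemma keys_basis [simp]: "Poly_Mapping.keys (basis b) = {b}"
  by (simp add: basis_def)

text \<open>Terms outside the support vanish. A common index set is what additivity needs, since
  cancellation may make \<open>keys (g + h)\<close> smaller than the union.\<close>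

lemma lin_ext_superset:
  assumes "finite K" "Poly_Mapping.keys h \<subseteq> K"
  shows "lin_ext f h = (\<Sum>b\<in>K. smult (Poly_Mapping.lookup h b) (f b))"
  unfolding lin_ext_def using assms
  by (intro sum.mono_neutral_left) (auto simp: in_keys_iff)

lemma lin_ext_basis [simp]: "lin_ext f (basis b) = f b"
  by (simp add: lin_ext_def lookup_basis)

lemma lin_ext_zero [simp]: "lin_ext f 0 = 0"
  by (simp add: lin_ext_def)

lemma lin_ext_add: "lin_ext f (g + h) = lin_ext f g + lin_ext f h"
proof -
  let ?K = "Poly_Mapping.keys g \<union> Poly_Mapping.keys h"
  have "lin_ext f k = (\<Sum>b\<in>?K. smult (Poly_Mapping.lookup k b) (f b))"
    if "k \<in> {g, h, g + h}" for k
    using that Poly_Mapping.keys_add[of g h] by (intro lin_ext_superset) auto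
  then show ?thesis
    by (simp add: lookup_add smult_add_left sum.distrib)
qed

lemma lin_ext_sum: "lin_ext f (\<Sum>x\<in>A. h x) = (\<Sum>x\<in>A. lin_ext f (h x))"
  by (induction A rule: infinite_finite_induct) (auto simp: lin_ext_add)

lemma keys_lin_ext: "Poly_Mapping.keys (lin_ext f h) \<subseteq> (\<Union>b\<in>Poly_Mapping.keys h. Poly_Mapping.keys (f b))"
proof
  fix x
  assume "x \<in> Poly_Mapping.keys (lin_ext f h)"
  then have "(\<Sum>b\<in>Poly_Mapping.keys h. Poly_Mapping.lookup h b * Poly_Mapping.lookup (f b) x) \<noteq> 0"
    by (simp add: in_keys_iff lin_ext_def lookup_sum)
  then obtain b where "b \<in> Poly_Mapping.keys h"
      "Poly_Mapping.lookup h b * Poly_Mapping.lookup (f b) x \<noteq> 0"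
    by (meson sum.neutral)
  then show "x \<in> (\<Union>b\<in>Poly_Mapping.keys h. Poly_Mapping.keys (f b))"
    by (auto simp: in_keys_iff)
qed

section \<open>Coproduct, convolution and selectors on basis elements\<close>

lemma coproduct_basis: "coproduct M (basis S) =
    (\<Sum>A\<in>Pow (ground M S). basis (del_set M S (ground M S - A), con_set M S A))"
  by (simp add: coproduct_def)

lemma convolution_basis: "convolution M f g (basis S) =
    (\<Sum>A\<in>Pow (ground M S).
      f (basis (del_set M S (ground M S - A))) * g (basis (con_set M S A)))"
  by (simp add: convolution_def tensor_mult_def coproduct_basis lin_ext_sum)

lemma counit_basis: "counit M (basis S) = (if S \<in> grade M 0 then 1 else 0)"
  by (simp add: counit_def lookup_basis)

lemma tensor_pow_basis: "tensor_pow f (basis Ts) = prod_list (map (\<lambda>T. f (basis T)) Ts)"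
  by (simp add: tensor_pow_def)

lemma selector_basis:
  assumes "inj_on obj I"
  shows "i \<in> I \<Longrightarrow> selector I obj a (basis (obj i)) = a i"
    and "T \<notin> obj ` I \<Longrightarrow> selector I obj a (basis T) = 0"
proof -
  assume i: "i \<in> I"
  have "(smult (coord (obj l) (basis (obj i))) (a l) when l \<in> I) = (a l when l = i)" for l
    using assms i by (auto simp: coord_def lookup_basis when_def inj_on_eq_iff)
  then show "selector I obj a (basis (obj i)) = a i"
    unfolding selector_def by simp
next
  assume "T \<notin> obj ` I"
  then have "(smult (coord (obj l) (basis T)) (a l) when l \<in> I) = 0" for l
    by (auto simp: coord_def lookup_basis when_def)
  then show "selector I obj a (basis T) = 0"
    unfolding selector_def by simp
qed


section \<open>Minors\<close>

context minors_system
begin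

lemma finite_set_obtain_list:
  assumes "A \<subseteq> ground M S"
  obtains es where "distinct es" "set es = A"
  using finite_subset[OF assms finite_ground] finite_distinct_list by metis

lemma del_set_empty [simp]: "del_set M S {} = S"
  using del_set_eq_foldl[of "[]" S] by simp

lemma con_set_empty [simp]: "con_set M S {} = S"
  using con_set_eq_foldl[of "[]" S] by simp

lemma del_set_insert:
  assumes "e \<in> ground M S" "A \<subseteq> ground M S" "e \<notin> A"
  shows "del_set M S (insert e A) = del_set M (del M S e) A"
proof -
  obtain es where es: "distinct es" "set es = A"
    using assms by (elim finite_set_obtain_list)
  then show ?thesis
    using del_set_eq_foldl[of "e # es" S] del_set_eq_foldl[of es "del M S e"] assms
    by (auto simp: ground_del subset_Diff_insert)
qed

lemma con_set_insert:
  assumes "e \<in> ground M S" "A \<subseteq> ground M S" "e \<notin> A"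
  shows "con_set M S (insert e A) = con_set M (con M S e) A"
proof -
  obtain es where es: "distinct es" "set es = A"
    using assms by (elim finite_set_obtain_list)
  then show ?thesis
    using con_set_eq_foldl[of "e # es" S] con_set_eq_foldl[of es "con M S e"] assms
    by (auto simp: ground_con subset_Diff_insert)
qed

lemma con_set_singleton: "e \<in> ground M S \<Longrightarrow> con_set M S {e} = con M S e"
  using con_set_insert[of e S "{}"] by simp

text \<open>The induction hypothesis covers every \<open>T\<close> on the ground set without
  \<open>e\<close>, so one rule serves both deletion and contraction of \<open>e\<close>.\<close>

lemma subset_ground_induct [consumes 1, case_names empty insert]:
  assumes "A \<subseteq> ground M S"
    and "\<And>S. P S {}"
    and "\<And>S e A. \<lbrakk>e \<in> ground M S; A \<subseteq> ground M S; e \<notin> A;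
      \<And>T. ground M T = ground M S - {e} \<Longrightarrow> P T A\<rbrakk> \<Longrightarrow> P S (insert e A)"
  shows "P S A"
  using finite_subset[OF assms(1) finite_ground] assms(1)
proof (induction A arbitrary: S rule: finite_induct)
  case empty
  show ?case by (rule assms(2))
next
  case (insert e A)
  then show ?case by (intro assms(3)) auto
qed

lemma ground_del_set: "A \<subseteq> ground M S \<Longrightarrow> ground M (del_set M S A) = ground M S - A"
  by (induction S A rule: subset_ground_induct) (auto simp: del_set_insert ground_del)

lemma del_set_Un:
  "\<lbrakk>A \<subseteq> ground M S; B \<subseteq> ground M S - A\<rbrakk>
    \<Longrightarrow> del_set M (del_set M S A) B = del_set M S (A \<union> B)"
proof (induction S A rule: subset_ground_induct)
  case (insert S e A)
  have "del_set M S (insert e (A \<union> B)) = del_set M (del M S e) (A \<union> B)"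
    using insert by (intro del_set_insert) auto
  moreover have "del_set M (del_set M (del M S e) A) B = del_set M (del M S e) (A \<union> B)"
    using insert.hyps insert.prems by (intro insert.IH) (auto simp: ground_del)
  ultimately show ?case
    using insert.hyps by (simp add: del_set_insert)
qed simp

text \<open>The contraction moves past the deletions one element at a time, by the mixed axiom
  \<open>con_del\<close>.\<close>

lemma con_del_set:
  "\<lbrakk>A \<subseteq> ground M S; f \<in> ground M S - A\<rbrakk>
    \<Longrightarrow> con M (del_set M S A) f = del_set M (con M S f) A"
proof (induction S A rule: subset_ground_induct)
  case (insert S e A)
  have "con M (del_set M S (insert e A)) f = con M (del_set M (del M S e) A) f"
    using insert.hyps by (simp add: del_set_insert)
  also have "\<dots> = del_set M (con M (del M S e) f) A"
    using insert.hyps insert.prems by (intro insert.IH) (auto simp: ground_del)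
  also have "con M (del M S e) f = del M (con M S f) e"
    using insert.hyps insert.prems by (intro con_del[symmetric]) auto
  also have "del_set M \<dots> A = del_set M (con M S f) (insert e A)"
    using insert.hyps insert.prems by (intro del_set_insert[symmetric]) (auto simp: ground_con)
  finally show ?case .
qed simp

lemma grade_0_iff: "S \<in> grade M 0 \<longleftrightarrow> ground M S = {}"
  by (simp add: grade_def finite_ground)

lemma ground_induct [case_names empty con]:
  assumes "\<And>S. ground M S = {} \<Longrightarrow> P S"
    and "\<And>S e. \<lbrakk>e \<in> ground M S; P (con M S e)\<rbrakk> \<Longrightarrow> P S"
  shows "P S"
proof (induction "card (ground M S)" arbitrary: S)
  case 0
  then show ?case by (simp add: assms(1) finite_ground)
next
  case (Suc n)
  then obtain e where e: "e \<in> ground M S"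
    by fastforce
  then have "P (con M S e)"
    using Suc.hyps(2) finite_ground[of S] by (intro Suc.hyps(1)) (simp add: ground_con)
  with e show ?case by (rule assms(2))
qed

end


section \<open>Weights determined by contraction\<close>

text \<open>Abstracts from the rank functions: \<open>F\<close> turns out to be the convolution
  exponential of \<open>f\<close> on basis elements. The same setting serves the \<open>x\<close>
  and the \<open>y\<close> variables.\<close>

locale contraction_weight = minors_system M unit_obj
  for M :: "('s, 'e) minors" and unit_obj :: 's +
  fixes f :: "('s \<Rightarrow>\<^sub>0 'k::field_char_0) \<Rightarrow> ('v::comm_monoid_add \<Rightarrow>\<^sub>0 'k)"
    and F :: "'s \<Rightarrow> ('v \<Rightarrow>\<^sub>0 'k)"
  assumes supp: "T \<notin> grade M 1 \<Longrightarrow> f (basis T) = 0"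
    and weight_unit: "S \<in> grade M 0 \<Longrightarrow> F S = 1"
    and weight_con: "e \<in> ground M S
      \<Longrightarrow> F S = f (basis (del_set M S (ground M S - {e}))) * F (con M S e)"
begin

text \<open>The left factor of the summand for \<open>A\<close> has ground set \<open>A\<close>, so
  \<open>supp\<close> kills it unless \<open>A\<close> is a singleton.\<close>

lemma convolution_eq_sum_elements:
  "convolution M f g (basis S) =
    (\<Sum>e\<in>ground M S. f (basis (del_set M S (ground M S - {e}))) * g (basis (con M S e)))"
proof -
  have "convolution M f g (basis S) = (\<Sum>A\<in>(\<lambda>e. {e}) ` ground M S.
      f (basis (del_set M S (ground M S - A))) * g (basis (con_set M S A)))"
    unfolding convolution_basis
  proof (intro sum.mono_neutral_right ballI)
    fix A
    assume A: "A \<in> Pow (ground M S) - (\<lambda>e. {e}) ` ground M S"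
    have "ground M S - (ground M S - A) = A"
      using A by auto
    then have "del_set M S (ground M S - A) \<notin> grade M 1"
      using A by (auto simp: grade_def ground_del_set card_1_singleton_iff)
    then show "f (basis (del_set M S (ground M S - A))) * g (basis (con_set M S A)) = 0"
      by (simp add: supp)
  qed (auto simp: finite_ground)
  also have "\<dots> = (\<Sum>e\<in>ground M S.
      f (basis (del_set M S (ground M S - {e}))) * g (basis (con_set M S {e})))"
    by (subst sum.reindex) auto
  finally show ?thesis
    by (simp add: con_set_singleton)
qed

lemma conv_pow_basis:
  "conv_pow M f n (basis S) = (if card (ground M S) = n then smult (fact n) (F S) else 0)"
proof (induction n arbitrary: S)
  case 0
  show ?case
    using weight_unit[of S] by (simp add: counit_basis grade_def)
next
  case (Suc n)
  have "conv_pow M f (Suc n) (basis S) =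
      (\<Sum>e\<in>ground M S. if card (ground M S) = Suc n then smult (fact n) (F S) else 0)"
    unfolding conv_pow.simps convolution_eq_sum_elements
  proof (intro sum.cong refl)
    fix e
    assume e: "e \<in> ground M S"
    \<comment> \<open>The ground set contains \<open>e\<close>, so its cardinality is positive and
      truncated subtraction of 1 does no harm.\<close>
    then have "card (ground M (con M S e)) = n \<longleftrightarrow> card (ground M S) = Suc n"
      using finite_ground[of S] card_gt_0_iff[of "ground M S"] by (auto simp: ground_con)
    then show "f (basis (del_set M S (ground M S - {e}))) * conv_pow M f n (basis (con M S e)) =
        (if card (ground M S) = Suc n then smult (fact n) (F S) else 0)"
      using e by (simp add: Suc.IH mult_smult_right flip: weight_con)
  qed
  then show ?case
    \<comment> \<open>When the cardinality is \<open>Suc n\<close>, that many equal terms raise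
      \<open>fact n\<close> to \<open>fact (Suc n)\<close>. The rule \<open>sum_constant\<close>
      would turn the sum into a ring product instead of a scalar multiple.\<close>
    by (simp add: sum_const_smult algebra_simps del: sum_constant)
qed

text \<open>Only the term whose index is the grade of \<open>S\<close> survives in the series, and
  there the factorials cancel.\<close>

lemma conv_exp_basis: "conv_exp M f (basis S) = F S"
proof -
  have "smult (1 / fact n) (conv_pow M f n (basis S)) = (F S when n = card (ground M S))" for n
    by (simp add: conv_pow_basis when_def)
  then show ?thesis
    unfolding conv_exp_def by simp
qed

lemma weight_grade_1:
  assumes "S \<in> grade M 1"
  shows "F S = f (basis S)"
proof -
  obtain e where e: "ground M S = {e}"
    using assms by (auto simp: grade_def card_1_singleton_iff)
  then have "con M S e \<in> grade M 0"
    by (simp add: grade_0_iff ground_con)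
  then show ?thesis
    using weight_con[of e S] weight_unit[of "con M S e"] e by simp
qed

text \<open>The value \<open>F S\<close> does not mention \<open>Ts\<close>, which is uniformity. A
  first tensor factor in grade 1 forces a singleton \<open>A = {e}\<close>, and
  \<open>weight_con\<close> then reduces to the remaining factors, a summand for the contraction by
  \<open>e\<close>.\<close>

lemma tensor_pow_summand:
  assumes "Ts \<in> Poly_Mapping.keys (iter_coproduct M n (basis S) :: 's list \<Rightarrow>\<^sub>0 'k)"
    and "set Ts \<subseteq> grade M 1"
  shows "tensor_pow f (basis Ts) = F S"
  using assms
proof (induction n arbitrary: S Ts)
  case 0
  then show ?case
    by (simp add: tensor_pow_basis weight_grade_1)
next
  case (Suc n)
  have "iter_coproduct M (Suc n) (basis S) = (\<Sum>A\<in>Pow (ground M S).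
      lin_ext (\<lambda>Us. basis (del_set M S (ground M S - A) # Us))
        (iter_coproduct M n (basis (con_set M S A)) :: 's list \<Rightarrow>\<^sub>0 'k))"
    by (simp add: coproduct_basis lin_ext_sum)
  with Suc.prems(1) obtain A where A: "A \<subseteq> ground M S"
    and "Ts \<in> Poly_Mapping.keys (lin_ext (\<lambda>Us. basis (del_set M S (ground M S - A) # Us))
        (iter_coproduct M n (basis (con_set M S A)) :: 's list \<Rightarrow>\<^sub>0 'k))"
    using keys_sum by (smt (verit) UN_E PowD subsetD)
  then obtain Us
    where Us: "Us \<in> Poly_Mapping.keys (iter_coproduct M n (basis (con_set M S A)) :: 's list \<Rightarrow>\<^sub>0 'k)"
      and Ts: "Ts = del_set M S (ground M S - A) # Us"
    using keys_lin_ext by fastforce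
  have "ground M S - (ground M S - A) = A"
    using A by auto
  then obtain e where e: "A = {e}"
    using Suc.prems(2) by (auto simp: Ts grade_def ground_del_set card_1_singleton_iff)
  have "tensor_pow f (basis Us) = F (con_set M S A)"
    using Suc.prems(2) by (intro Suc.IH Us) (simp add: Ts)
  then show ?case
    using A weight_con[of e S] by (simp add: Ts e tensor_pow_basis con_set_singleton)
qed

lemma uniform: "uniform M f"
  unfolding uniform_def using tensor_pow_summand by metis

end


section \<open>Products of powers\<close>

text \<open>Finiteness matters because a product with infinitely many factors other than 1 takes the
  default value 1.\<close>

lemma prod_over_mult:
  assumes "finite {j \<in> J. f j \<noteq> 1}" "finite {j \<in> J. g j \<noteq> 1}"
  shows "prod_over J (\<lambda>j. f j * g j) = prod_over J f * prod_over J g"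
proof -
  have "prod_over J (\<lambda>j. f j * g j) =
      (\<Prod>j. (if j \<in> J then f j else 1) * (if j \<in> J then g j else 1))"
    unfolding prod_over_def by (intro Prod_any.cong) simp
  also have "\<dots> = prod_over J f * prod_over J g"
    unfolding prod_over_def
  proof (rule Prod_any.distrib)
    show "finite {j. (if j \<in> J then f j else 1) \<noteq> 1}"
      by (rule finite_subset[OF _ assms(1)]) (auto split: if_splits)
    show "finite {j. (if j \<in> J then g j else 1) \<noteq> 1}"
      by (rule finite_subset[OF _ assms(2)]) (auto split: if_splits)
  qed
  finally show ?thesis .
qed

lemma prod_over_cong: "(\<And>j. j \<in> J \<Longrightarrow> f j = g j) \<Longrightarrow> prod_over J f = prod_over J g"
  unfolding prod_over_def by (intro Prod_any.cong) simp

lemma prod_over_one [simp]: "prod_over J (\<lambda>j. 1) = 1"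
  by (simp add: prod_over_def)

lemma x_pow_0 [simp]: "x_pow j 0 = 1"
  by (simp add: x_pow_def)

lemma y_pow_0 [simp]: "y_pow j 0 = 1"
  by (simp add: y_pow_def)

lemma x_pow_add: "x_pow j (p + q) = x_pow j p * x_pow j q"
  by (simp add: x_pow_def mult_single single_add)

lemma y_pow_add: "y_pow j (p + q) = y_pow j p * y_pow j q"
  by (simp add: y_pow_def mult_single single_add)

text \<open>Stated for an abstract \<open>pow\<close> so as to cover both \<open>x_pow\<close> and
  \<open>y_pow\<close>; a factor can differ from 1 only where its exponent is nonzero.\<close>

lemma prod_over_pow_add:
  fixes pow :: "'j \<Rightarrow> rat \<Rightarrow> 'a::comm_monoid_mult"
  assumes "\<And>j. pow j 0 = 1" "\<And>j p q. pow j (p + q) = pow j p * pow j q"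
    and "finite {j \<in> J. p j \<noteq> 0}" "finite {j \<in> J. q j \<noteq> 0}"
  shows "prod_over J (\<lambda>j. pow j (p j + q j)) =
    prod_over J (\<lambda>j. pow j (p j)) * prod_over J (\<lambda>j. pow j (q j))"
  unfolding assms(2)
proof (rule prod_over_mult)
  show "finite {j \<in> J. pow j (p j) \<noteq> 1}"
    by (rule finite_subset[OF _ assms(3)]) (auto simp: assms(1))
  show "finite {j \<in> J. pow j (q j) \<noteq> 1}"
    by (rule finite_subset[OF _ assms(4)]) (auto simp: assms(1))
qed


section \<open>Rank functions\<close>

text \<open>\<open>finite_m\<close> makes each weight a genuine monomial even when \<open>J\<close>
  is infinite.\<close>

locale rank_system = minors_system M unit_obj
  for M :: "('s, 'e) minors" and unit_obj :: 's +
  fixes I :: "'i set" and obj :: "'i \<Rightarrow> 's"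
    and J :: "'j set" and r :: "'j \<Rightarrow> 's \<Rightarrow> rat" and m :: "'i \<Rightarrow> 'j \<Rightarrow> rat"
  assumes bij_obj: "bij_betw obj I (grade M 1)"
    and finite_m: "i \<in> I \<Longrightarrow> finite {j \<in> J. m i j \<noteq> 0}"
    and rank_0: "\<lbrakk>j \<in> J; S \<in> grade M 0\<rbrakk> \<Longrightarrow> r j S = 0"
    and rank_con: "\<lbrakk>j \<in> J; e \<in> ground M S; i \<in> I; del_set M S (ground M S - {e}) = obj i\<rbrakk>
      \<Longrightarrow> r j S = r j (con M S e) + m i j"
begin

lemma obtain_index:
  assumes "e \<in> ground M S"
  obtains i where "i \<in> I" "del_set M S (ground M S - {e}) = obj i"
proof -
  have "ground M S - (ground M S - {e}) = {e}"
    using assms by auto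
  then have "del_set M S (ground M S - {e}) \<in> grade M 1"
    by (simp add: grade_def ground_del_set)
  then show ?thesis
    using bij_obj that by (auto simp: bij_betw_def)
qed

text \<open>Undoing one contraction changes \<open>r j\<close> by \<open>m i j\<close>, which is
  nonzero for finitely many \<open>j\<close> only, and the ground set is finite.\<close>

lemma finite_rank: "finite {j \<in> J. r j S \<noteq> 0}"
proof (induction S rule: ground_induct)
  case (empty S)
  then have "{j \<in> J. r j S \<noteq> 0} = {}"
    by (auto simp: rank_0 grade_0_iff)
  then show ?case by (simp only: finite.emptyI)
next
  case (con S e)
  obtain i where i: "i \<in> I" "del_set M S (ground M S - {e}) = obj i"
    using con by (elim obtain_index)
  have "{j \<in> J. r j S \<noteq> 0} \<subseteq> {j \<in> J. r j (con M S e) \<noteq> 0} \<union> {j \<in> J. m i j \<noteq> 0}"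
    using rank_con[OF _ con.hyps i] by auto
  then show ?case
    using con finite_m[OF i(1)] by (meson finite_UnI finite_subset)
qed

text \<open>Peeling \<open>e\<close> off \<open>A\<close> adds the same \<open>m i j\<close> to the
  rank of \<open>S\<close> and to that of its restriction to the peeled set, so the increments
  cancel.\<close>

lemma rank_decompose:
  assumes "j \<in> J" "A \<subseteq> ground M S"
  shows "r j S = r j (con_set M S A) + r j (del_set M S (ground M S - A))"
  using assms(2)
proof (induction S A rule: subset_ground_induct)
  case (empty S)
  have "del_set M S (ground M S) \<in> grade M 0"
    by (simp add: grade_0_iff ground_del_set)
  then show ?case
    using rank_0 assms(1) by simp
next
  case (insert S e A)
  define C where "C = ground M S - insert e A"
  have C: "C \<subseteq> ground M S" "e \<notin> C" "ground M S - {e} - A = C"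
      "ground M S - C = insert e A" "C \<union> A = ground M S - {e}"
    using insert.hyps by (auto simp: C_def)
  obtain i where i: "i \<in> I" "del_set M S (ground M S - {e}) = obj i"
    using insert.hyps by (elim obtain_index)
  \<comment> \<open>Restricting to \<open>e\<close> yields the same grade 1 object from
    \<open>S\<close> and from its restriction, hence the same index \<open>i\<close>.\<close>
  have "del_set M (del_set M S C) (ground M (del_set M S C) - {e}) = del_set M S (C \<union> A)"
    using insert.hyps C by (subst del_set_Un[symmetric]) (auto simp: ground_del_set)
  then have "r j (del_set M S C) = r j (con M (del_set M S C) e) + m i j"
    using insert.hyps C i by (intro rank_con assms(1)) (simp_all add: ground_del_set)
  moreover have "con M (del_set M S C) e = del_set M (con M S e) C"
    using insert.hyps C by (intro con_del_set) auto
  moreover have "r j (con M S e) = r j (con_set M (con M S e) A) + r j (del_set M (con M S e) C)"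
    using insert.IH[of "con M S e"] insert.hyps C by (simp add: ground_con)
  moreover have "r j S = r j (con M S e) + m i j"
    using insert.hyps i by (intro rank_con assms(1))
  ultimately show ?case
    using insert.hyps by (simp add: con_set_insert C_def)
qed

text \<open>Exponentiation turns the additive recursion for \<open>r j\<close> into the
  multiplicative one required of a weight.\<close>

lemma selector_contraction_weight:
  fixes pow :: "'j \<Rightarrow> rat \<Rightarrow> ('v::comm_monoid_add \<Rightarrow>\<^sub>0 'k::field_char_0)"
  assumes pow: "\<And>j. pow j 0 = 1" "\<And>j p q. pow j (p + q) = pow j p * pow j q"
    and a: "\<And>i. i \<in> I \<Longrightarrow> a i = prod_over J (\<lambda>j. pow j (m i j))"
  shows "contraction_weight M unit_obj (selector I obj a) (\<lambda>S. prod_over J (\<lambda>j. pow j (r j S)))"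
proof unfold_locales
  fix T
  assume "T \<notin> grade M 1"
  then show "selector I obj a (basis T) = 0"
    using bij_obj by (intro selector_basis(2)) (auto simp: bij_betw_def)
next
  fix S
  assume "S \<in> grade M 0"
  then have "prod_over J (\<lambda>j. pow j (r j S)) = prod_over J (\<lambda>j. 1)"
    by (intro prod_over_cong) (simp add: rank_0 pow)
  then show "prod_over J (\<lambda>j. pow j (r j S)) = 1"
    by simp
next
  fix S e
  assume e: "e \<in> ground M S"
  then obtain i where i: "i \<in> I" "del_set M S (ground M S - {e}) = obj i"
    by (elim obtain_index)
  have "prod_over J (\<lambda>j. pow j (r j S)) = prod_over J (\<lambda>j. pow j (m i j + r j (con M S e)))"
    by (intro prod_over_cong) (use rank_con e i in \<open>simp add: add.commute\<close>)
  also have "\<dots> = a i * prod_over J (\<lambda>j. pow j (r j (con M S e)))"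
    using i(1) unfolding a[OF i(1)]
    by (intro prod_over_pow_add pow finite_m finite_rank)
  also have "a i = selector I obj a (basis (del_set M S (ground M S - {e})))"
    using i by (simp add: selector_basis(1)[OF bij_betw_imp_inj_on[OF bij_obj]])
  finally show "prod_over J (\<lambda>j. pow j (r j S)) =
      selector I obj a (basis (del_set M S (ground M S - {e}))) *
      prod_over J (\<lambda>j. pow j (r j (con M S e)))" .
qed

text \<open>Solving \<open>rank_decompose\<close> for the rank of the contraction splits its
  \<open>y\<close> monomial into \<open>Y S\<close>, independent of \<open>A\<close>, and negative
  powers that pair with the \<open>x\<close> powers.\<close>

lemma x_div_y_decompose:
  fixes S defines "X \<equiv> \<lambda>T. prod_over J (\<lambda>j. x_pow j (r j T)) :: ('j, 'k::field_char_0) rat_poly"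
    and "Y \<equiv> \<lambda>T. prod_over J (\<lambda>j. y_pow j (r j T)) :: ('j, 'k) rat_poly"
  assumes A: "A \<subseteq> ground M S"
  shows "X (del_set M S (ground M S - A)) * Y (con_set M S A) =
    Y S * prod_over J (\<lambda>j. x_div_y_pow j (r j (del_set M S (ground M S - A))))"
proof -
  let ?D = "del_set M S (ground M S - A)"
  have fin: "finite {j \<in> J. x_pow j (r j T) \<noteq> (1 :: ('j, 'k) rat_poly)}"
    "finite {j \<in> J. y_pow j (- r j T) \<noteq> (1 :: ('j, 'k) rat_poly)}" for T
    by (rule finite_subset[OF _ finite_rank[of T]]; auto)+
  have "Y (con_set M S A) = prod_over J (\<lambda>j. y_pow j (r j S + (- r j ?D)))"
    unfolding Y_def using rank_decompose[OF _ A] by (intro prod_over_cong) simp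
  also have "\<dots> = Y S * prod_over J (\<lambda>j. y_pow j (- r j ?D))"
    unfolding Y_def using finite_rank
    by (intro prod_over_pow_add[where pow = y_pow]) (auto simp: y_pow_add)
  finally show ?thesis
    unfolding x_div_y_pow_def X_def by (simp add: prod_over_mult fin ac_simps)
qed

end

theorem theorem2p6:
  fixes M :: "('s, 'e) minors" and unit_obj :: 's and mult :: "'s \<Rightarrow> 's \<Rightarrow> 's"
    and I :: "'i set" and obj :: "'i \<Rightarrow> 's"
    and J :: "'j set" and r :: "'j \<Rightarrow> 's \<Rightarrow> rat" and m :: "'i \<Rightarrow> 'j \<Rightarrow> rat"
    and a b :: "'i \<Rightarrow> ('j, 'k::field_char_0) rat_poly"
  assumes "minors_hopf_algebra M unit_obj mult"
    and "bij_betw obj I (grade M 1)"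
    and "\<And>i. i \<in> I \<Longrightarrow> finite {j \<in> J. m i j \<noteq> 0}"
    and "\<And>j S. j \<in> J \<Longrightarrow> S \<in> grade M 0 \<Longrightarrow> r j S = 0"
    and "\<And>j S e i. \<lbrakk>j \<in> J; e \<in> ground M S; i \<in> I;
           coord (obj i) (basis (del_set M S (ground M S - {e})) :: 's \<Rightarrow>\<^sub>0 'k) = 1\<rbrakk>
         \<Longrightarrow> r j S = r j (con M S e) + m i j"
    and "\<And>i. i \<in> I \<Longrightarrow> a i = prod_over J (\<lambda>j. x_pow j (m i j))"
    and "\<And>i. i \<in> I \<Longrightarrow> b i = prod_over J (\<lambda>j. y_pow j (m i j))"
  shows "uniform M (selector I obj a) \<and>
    (\<forall>S. tutte_poly M I obj a b (basis S) =
      prod_over J (\<lambda>j. y_pow j (r j S)) *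
      (\<Sum>A\<in>Pow (ground M S).
        prod_over J (\<lambda>j. x_div_y_pow j (r j (del_set M S (ground M S - A))))))"
proof -
  interpret minors_hopf_algebra M unit_obj mult by fact
  \<comment> \<open>A coordinate of a basis element is 1 exactly when the two objects agree, so the
    hypothesis on \<open>coord\<close> becomes an equation between objects.\<close>
  interpret rank_system M unit_obj I obj J r m
    using assms(2-5) by unfold_locales (auto simp: coord_def lookup_basis)
  interpret A: contraction_weight M unit_obj "selector I obj a" "\<lambda>S. prod_over J (\<lambda>j. x_pow j (r j S))"
    by (intro selector_contraction_weight) (simp_all add: x_pow_add assms(6))
  interpret B: contraction_weight M unit_obj "selector I obj b" "\<lambda>S. prod_over J (\<lambda>j. y_pow j (r j S))"
    by (intro selector_contraction_weight) (simp_all add: y_pow_add assms(7))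
  show ?thesis
    by (simp add: A.uniform tutte_poly_def convolution_basis A.conv_exp_basis B.conv_exp_basis
        x_div_y_decompose sum_distrib_left)
qed

end
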